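(* Let $n,k,m,r$ be positive integers with $r\le k\le m$. Then: (i) $N(n,k,m;r)\geq rn$. (ii) $N(n,k,m;r)\geq N(n,k,m;i)$ for every $i\in [r-1]=\{1,\dots,r-1\}$. (iii) $\frac{1}{r}N(rn,k,m)\leq N(n,k,m;r)\leq N(rn,k,m)$. (iv) $N(n,k,m;r)\leq rN\left(n,\left\lceil\frac{k}{r}\right\rceil,\left\lfloor\frac{m}{r}\right\rfloor\right)$. (v) If $r\leq k-1$, then for every integer $c\in[r,k-1]$, $$N(n,k,m;r)\geq nc-\left\lfloor\frac{k-c}{m-k+1}\left[\frac{\left\lfloor\frac{k-1}{r}\right\rfloor{m\choose k-1}}{{m-c\choose k-1-c}}-n\right]\right\rfloor.$$
   Context: An $(n,N,k,m;r)$ multiset combinatorial batch code (MCBC) is a collection $\mathcal C=\{C_1,\dots,C_m\}$ of subsets of $[n]=\{1,\dots,n\}$ (servers) with $N=\sum_{j=1}^m|C_j|$, such that for every multiset request $\{i_1,\dots,i_k\}$ of $k$ elements of $[n]$ in which every element has multiplicity at most $r$, there exist subsets $D_j\subseteq C_j$ with $|D_j|\le 1$ ($j\in[m]$) whose multiset union (the multiplicity of $i$ being $|\{j: i\in D_j\}|$) contains the request. $N(n,k,m;r)$ denotes the smallest $N$ for which an $(n,N,k,m;r)$-MCBC exists. When $r=1$ the code is called an $(n,N,k,m)$ combinatorial batch code (CBC) and the minimum is written $N(n,k,m)=N(n,k,m;1)$.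
   Formalization: Part (i) is stated only for k ≤ rn: if k > rn there are no admissible requests, so N(n,k,m;r) = 0 and (i) fails (e.g. n = r = 1, k = m = 2); in (iv) the minimum is taken as infinity when no CBC with those parameters exists. *)

theory Defs
  imports Complex_Main "HOL-Library.Multiset" "HOL-Library.Extended_Real"
begin

text \<open>
  The collection is an indexed family, so a server may store nothing and two servers may
  store the same set.
\<close>

definition mcbc :: "nat \<Rightarrow> nat \<Rightarrow> nat \<Rightarrow> nat \<Rightarrow> nat \<Rightarrow> (nat \<Rightarrow> nat set) \<Rightarrow> bool" where
  "mcbc n N k m r C \<longleftrightarrow>
     (\<forall>j\<in>{1..m}. C j \<subseteq> {1..n}) \<and>
     N = (\<Sum>j\<in>{1..m}. card (C j)) \<and>
     (\<forall>q. size q = k \<and> set_mset q \<subseteq> {1..n} \<and> (\<forall>i. count q i \<le> r) \<longrightarrow>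
        (\<exists>D. (\<forall>j\<in>{1..m}. D j \<subseteq> C j \<and> card (D j) \<le> 1) \<and>
             q \<subseteq># (\<Sum>j\<in>{1..m}. mset_set (D j))))"

text \<open>
  The smallest total storage; it is \<open>\<infinity>\<close> when no code with these parameters exists
  (which requires \<open>k > m\<close>, see \<open>mcbc_exists\<close> below).
\<close>

definition mcbc_min :: "nat \<Rightarrow> nat \<Rightarrow> nat \<Rightarrow> nat \<Rightarrow> enat" where
  "mcbc_min n k m r = (INF N\<in>{N. \<exists>C. mcbc n N k m r C}. enat N)"

abbreviation cbc_min :: "nat \<Rightarrow> nat \<Rightarrow> nat \<Rightarrow> enat" where
  "cbc_min n k m \<equiv> mcbc_min n k m 1"

lemma mcbc_exists:
  assumes "k \<le> m"
  shows "\<exists>N C. mcbc n N k m r C"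
proof -
  have sum_nth: "(\<Sum>j<length xs. {#xs ! j#}) = mset xs" for xs :: "nat list"
    by (induction xs rule: rev_induct) (auto simp: nth_append)
  have "\<exists>D. (\<forall>j\<in>{1..m}. D j \<subseteq> {1..n} \<and> card (D j) \<le> 1) \<and>
             q \<subseteq># (\<Sum>j\<in>{1..m}. mset_set (D j))"
    if q: "size q = k" "set_mset q \<subseteq> {1..n}" for q
  proof -
    obtain xs where xs: "mset xs = q" using ex_mset by blast
    with q have len: "length xs = k" by auto
    define D where "D j = (if j \<le> k then {xs ! (j - 1)} else {})" for j
    have "D j \<subseteq> {1..n} \<and> card (D j) \<le> 1" if "j \<in> {1..m}" for j
    proof (cases "j \<le> k")
      case True
      with that len have "xs ! (j - 1) \<in> set xs" by (intro nth_mem) auto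
      with xs q have "xs ! (j - 1) \<in> {1..n}" by auto
      with True show ?thesis by (simp add: D_def)
    qed (simp add: D_def)
    moreover have "(\<Sum>j\<in>{1..m}. mset_set (D j)) = q"
    proof -
      have "(\<Sum>j\<in>{1..m}. mset_set (D j)) = (\<Sum>j\<in>{1..k}. mset_set (D j))"
        using assms by (intro sum.mono_neutral_right) (auto simp: D_def)
      also have "\<dots> = (\<Sum>j<k. {#xs ! j#})"
        by (rule sum.reindex_bij_witness[of _ Suc "\<lambda>j. j - 1"]) (auto simp: D_def)
      finally show ?thesis using sum_nth[of xs] xs len by simp
    qed
    ultimately show ?thesis by (metis subset_mset.order_refl)
  qed
  then have "mcbc n (\<Sum>j\<in>{1..m}. card {1..n}) k m r (\<lambda>_. {1..n})"
    unfolding mcbc_def by blast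
  then show ?thesis by blast
qed

lemma mcbc_min_attained:
  assumes "k \<le> m"
  shows "\<exists>N C. mcbc_min n k m r = enat N \<and> mcbc n N k m r C"
proof -
  define S where "S = enat ` {N. \<exists>C. mcbc n N k m r C}"
  obtain N C where "mcbc n N k m r C" using mcbc_exists[OF assms] by metis
  then have "enat N \<in> S" unfolding S_def by blast
  then have "Inf S \<in> S" by (rule wellorder_InfI)
  moreover have "mcbc_min n k m r = Inf S" by (simp only: mcbc_min_def S_def)
  ultimately have "mcbc_min n k m r \<in> enat ` {N. \<exists>C. mcbc n N k m r C}" by (simp only: S_def)
  then obtain N where "mcbc_min n k m r = enat N" "N \<in> {N. \<exists>C. mcbc n N k m r C}" by (rule imageE)
  then show ?thesis by blast
qed

text \<open>
  For \<open>r * n < k\<close> there is no admissible request at all, so the empty servers form a code.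
\<close>

lemma mcbc_min_degenerate:
  assumes "r * n < k"
  shows "mcbc_min n k m r = 0"
proof -
  have "False" if "size q = k" "set_mset q \<subseteq> {1..n}" "\<forall>i. count q i \<le> r" for q :: "nat multiset"
  proof -
    have "size q = (\<Sum>i\<in>set_mset q. count q i)" by (simp add: size_multiset_overloaded_eq)
    also have "\<dots> \<le> (\<Sum>i\<in>{1..n}. count q i)" using that by (intro sum_mono2) auto
    also have "\<dots> \<le> (\<Sum>i\<in>{1..n}. r)" using that by (intro sum_mono) auto
    finally show False using that assms by (simp add: mult.commute)
  qed
  then have "mcbc n 0 k m r (\<lambda>_. {})" unfolding mcbc_def card.empty sum.neutral_const by blast
  then have "mcbc_min n k m r \<le> enat 0"
    unfolding mcbc_min_def by (intro INF_lower) auto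
  then show ?thesis by (metis zero_enat_def le_zero_eq)
qed

end

theory Submission
  imports Defs
begin

text \<open>
  For (iii), a request with multiplicities at most \<open>r\<close> on \<open>n\<close> items is the same as a set of
  \<open>r * n\<close> items, \<open>r\<close> copies of each; codes are transported along the projection of the copies.
  For (iv), a request splits into \<open>r\<close> sets of nearly equal size, each served by its own block
  of servers.
  For (v), let \<open>B i\<close> be the set of servers storing item \<open>i\<close>. A set of \<open>k - 1\<close> servers contains at
  most \<open>(k - 1) div r\<close> of the \<open>B i\<close>, since otherwise \<open>k\<close> copies of the items involved could be
  requested. Double counting bounds the sum over \<open>i\<close> of the number of \<open>(k - 1)\<close>-sets containing
  \<open>B i\<close>. This number is a convex function of the size of \<open>B i\<close>, so it lies above the line through
  its values at \<open>c - 1\<close> and \<open>c\<close>; summing the linear bound gives the estimate for \<open>N\<close>.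
\<close>

section \<open>Passing between codes and the minimal storage\<close>

text \<open>The exhibited code may store less than \<open>N\<close>. This slack is wanted when items
  are merged on a server and only an upper bound on its load is known.\<close>

lemma mcbc_minI:
  assumes "\<And>j. j \<in> {1..m} \<Longrightarrow> C j \<subseteq> {1..n}"
    and "\<And>q. size q = k \<Longrightarrow> set_mset q \<subseteq> {1..n} \<Longrightarrow> (\<And>i. count q i \<le> r) \<Longrightarrow>
       \<exists>D. (\<forall>j\<in>{1..m}. D j \<subseteq> C j \<and> card (D j) \<le> 1) \<and> q \<subseteq># (\<Sum>j\<in>{1..m}. mset_set (D j))"
    and "(\<Sum>j\<in>{1..m}. card (C j)) \<le> N"
  shows "mcbc_min n k m r \<le> enat N"
proof -
  have "mcbc n (\<Sum>j\<in>{1..m}. card (C j)) k m r C"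
    unfolding mcbc_def using assms(1,2) by blast
  then have "mcbc_min n k m r \<le> enat (\<Sum>j\<in>{1..m}. card (C j))"
    unfolding mcbc_min_def by (intro INF_lower) blast
  also have "\<dots> \<le> enat N" using assms(3) by simp
  finally show ?thesis .
qed

text \<open>A finite infimum comes from a nonempty set, and \<open>enat\<close> is well-ordered, so
  it is attained. Assuming finiteness instead of \<open>k \<le> m\<close> fits the case distinctions
  on the minimum made below.\<close>

lemma mcbc_min_enatE:
  assumes "mcbc_min n k m r = enat N"
  obtains C where "mcbc n N k m r C"
proof -
  define S where "S = enat ` {N. \<exists>C. mcbc n N k m r C}"
  have min: "enat N = Inf S" using assms by (simp only: mcbc_min_def S_def)
  then have "S \<noteq> {}" by (auto simp: Inf_enat_def)
  then have "enat N \<in> S" unfolding min by (meson all_not_in_conv wellorder_InfI)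
  then show thesis using that unfolding S_def by blast
qed

lemma mcbc_servers: "mcbc n N k m r C \<Longrightarrow> j \<in> {1..m} \<Longrightarrow> C j \<subseteq> {1..n}"
  and mcbc_size: "mcbc n N k m r C \<Longrightarrow> N = (\<Sum>j\<in>{1..m}. card (C j))"
  by (auto simp: mcbc_def)

lemma mcbc_serve:
  assumes "mcbc n N k m r C" "size q = k" "set_mset q \<subseteq> {1..n}" "\<And>i. count q i \<le> r"
  shows "\<exists>D. (\<forall>j\<in>{1..m}. D j \<subseteq> C j \<and> card (D j) \<le> 1) \<and> q \<subseteq># (\<Sum>j\<in>{1..m}. mset_set (D j))"
  using assms unfolding mcbc_def by blast

section \<open>Servers forced by a request, and bound (i)\<close>

text \<open>Each server hands out at most one item, so as many servers as there are requested copies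
  must hand out something that was asked for. Both lower bounds (i) and (v) rest on this.\<close>

lemma size_le_card_hit:
  assumes "finite J" "\<And>j. j \<in> J \<Longrightarrow> card (D j) \<le> 1" "\<And>j. j \<in> J \<Longrightarrow> finite (D j)"
    and "q \<subseteq># (\<Sum>j\<in>J. mset_set (D j))"
  shows "size q \<le> card {j \<in> J. set_mset q \<inter> D j \<noteq> {}}"
proof -
  define P where "P x \<longleftrightarrow> x \<in># q" for x
  have "size (filter_mset P (\<Sum>j\<in>J. mset_set (D j))) = (\<Sum>j\<in>J. card (set_mset q \<inter> D j))"
    using assms(1,3)
  proof (induction J rule: finite_induct)
    case (insert j J)
    have "{x \<in> D j. P x} = set_mset q \<inter> D j" by (auto simp: P_def)
    with insert show ?case by simp
  qed simp
  also have "\<dots> \<le> (\<Sum>j\<in>J. if set_mset q \<inter> D j \<noteq> {} then 1 else 0)"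
  proof (intro sum_mono)
    fix j assume j: "j \<in> J"
    then have "card (set_mset q \<inter> D j) \<le> card (D j)" using assms(3) by (intro card_mono) auto
    with j assms(2) show "card (set_mset q \<inter> D j) \<le> (if set_mset q \<inter> D j \<noteq> {} then 1 else 0)"
      using le_trans by fastforce
  qed
  also have "\<dots> = card {j \<in> J. set_mset q \<inter> D j \<noteq> {}}"
    using assms(1) by (subst sum.inter_filter[symmetric]) auto
  finally have *: "size (filter_mset P (\<Sum>j\<in>J. mset_set (D j))) \<le> card {j \<in> J. set_mset q \<inter> D j \<noteq> {}}" .
  \<comment> \<open>Filtering leaves \<open>q\<close> unchanged, so the inclusion survives deleting
    everything unrequested from the right-hand side.\<close>
  have "q = filter_mset P q" by (rule multiset_eqI) (auto simp: P_def not_in_iff)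
  also have "\<dots> \<subseteq># filter_mset P (\<Sum>j\<in>J. mset_set (D j))"
    using assms(4) by (rule multiset_filter_mono)
  finally show ?thesis using * size_mset_mono le_trans by blast
qed

text \<open>Any \<open>k\<close> entries of the multiset holding each element of \<open>T\<close>
  exactly \<open>r\<close> times will do; a list order makes the choice concrete.\<close>

lemma ex_request:
  assumes "finite T" "k \<le> r * card T"
  obtains q where "size q = k" "set_mset q \<subseteq> T" "\<And>i. count q i \<le> r"
proof -
  define p where "p = (\<Sum>i\<in>T. replicate_mset r i)"
  have p: "size p = r * card T" "set_mset p \<subseteq> T" "count p i \<le> r" for i
    unfolding p_def using assms(1)
    by (induction T rule: finite_induct) (auto simp: count_sum)
  obtain xs where xs: "mset xs = p" using ex_mset by blast
  have sub: "mset (take k xs) \<subseteq># p"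
    unfolding xs[symmetric] by (metis append_take_drop_id mset_append mset_subset_eq_add_left)
  have "length xs = size p" using xs by auto
  then have "size (mset (take k xs)) = k" using p(1) assms(2) by simp
  moreover have "set_mset (mset (take k xs)) \<subseteq> T" using sub p(2) by (meson order_trans set_mset_mono)
  moreover have "count (mset (take k xs)) i \<le> r" for i
    using sub p(3) by (meson mset_subset_eq_count order_trans)
  ultimately show thesis using that by blast
qed

text \<open>Double counting of incidences. It turns total storage into a sum of replication numbers,
  and in \<open>mcbc_counting_bound\<close> it is reused with items as indices and sets of servers
  as elements.\<close>

lemma sum_card_eq_sum_replication:
  assumes "\<And>j. j \<in> J \<Longrightarrow> C j \<subseteq> A" "finite A" "finite J"
  shows "(\<Sum>j\<in>J. card (C j)) = (\<Sum>i\<in>A. card {j \<in> J. i \<in> C j})"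
proof -
  have "(\<Sum>j\<in>J. card (C j)) = (\<Sum>j\<in>J. card {i \<in> A. i \<in> C j})"
    using assms(1) by (intro sum.cong refl arg_cong[of _ _ card]) blast
  also have "\<dots> = (\<Sum>j\<in>J. \<Sum>i\<in>A. if i \<in> C j then 1 else 0)"
    using assms(2) by (simp add: sum.If_cases Collect_conj_eq)
  also have "\<dots> = (\<Sum>i\<in>A. \<Sum>j\<in>J. if i \<in> C j then 1 else 0)" by (rule sum.swap)
  also have "\<dots> = (\<Sum>i\<in>A. card {j \<in> J. i \<in> C j})"
    using assms(3) by (simp add: sum.If_cases Collect_conj_eq)
  finally show ?thesis .
qed

text \<open>A request containing \<open>i\<close> with full multiplicity \<open>r\<close> needs
  \<open>r\<close> different servers that store \<open>i\<close>.\<close>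

lemma mcbc_replication_ge:
  assumes C: "mcbc n N k m r C" and "i \<in> {1..n}" "r \<le> k" "k \<le> r * n"
  shows "r \<le> card {j \<in> {1..m}. i \<in> C j}"
proof (cases "r = 0")
  case False
  \<comment> \<open>Here \<open>k \<le> r * n\<close> enters: the other \<open>n - 1\<close> items
    leave room for the remaining \<open>k - r\<close> copies of the request.\<close>
  have "k - r \<le> r * card ({1..n} - {i})" using assms by (auto simp: diff_mult_distrib2)
  then obtain p where p: "size p = k - r" "set_mset p \<subseteq> {1..n} - {i}" "\<And>x. count p x \<le> r"
    using ex_request[of "{1..n} - {i}"] by blast
  define q where "q = p + replicate_mset r i"
  have "i \<notin># p" using p(2) by auto
  then have q3: "count q x \<le> r" for x using p(3) by (auto simp: q_def not_in_iff)
  have q: "size q = k" "set_mset q \<subseteq> {1..n}"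
    using p(1,2) assms(2,3) False by (auto simp: q_def split: if_splits)
  obtain D where D: "\<And>j. j \<in> {1..m} \<Longrightarrow> D j \<subseteq> C j" "\<And>j. j \<in> {1..m} \<Longrightarrow> card (D j) \<le> 1"
    "q \<subseteq># (\<Sum>j\<in>{1..m}. mset_set (D j))"
    using mcbc_serve[OF C q q3] by blast
  have fin: "finite (D j)" if "j \<in> {1..m}" for j
    using order_trans[OF D(1)[OF that] mcbc_servers[OF C that]] by (rule finite_subset) simp
  have "replicate_mset r i \<subseteq># q" by (simp add: q_def)
  then have sub: "replicate_mset r i \<subseteq># (\<Sum>j\<in>{1..m}. mset_set (D j))"
    using D(3) by (rule subset_mset.order_trans)
  have "size (replicate_mset r i) \<le> card {j \<in> {1..m}. set_mset (replicate_mset r i) \<inter> D j \<noteq> {}}"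
    by (rule size_le_card_hit[OF finite_atLeastAtMost D(2) fin sub])
  also have "\<dots> \<le> card {j \<in> {1..m}. i \<in> C j}"
    using D(1) False by (intro card_mono) auto
  finally show ?thesis by simp
qed simp

lemma mcbc_size_ge:
  assumes C: "mcbc n N k m r C" and "r \<le> k" "k \<le> r * n"
  shows "r * n \<le> N"
proof -
  have "r * n = (\<Sum>i\<in>{1..n}. r)" by simp
  also have "\<dots> \<le> (\<Sum>i\<in>{1..n}. card {j \<in> {1..m}. i \<in> C j})"
    using mcbc_replication_ge[OF C] assms(2,3) by (intro sum_mono) auto
  also have "\<dots> = N"
    using sum_card_eq_sum_replication[of "{1..m}" C "{1..n}"] mcbc_servers[OF C] mcbc_size[OF C]
    by simp
  finally show ?thesis .
qed

section \<open>Monotonicity in the multiplicity, (ii)\<close>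

lemma mcbc_min_mono_multiplicity:
  assumes "i \<le> r"
  shows "mcbc_min n k m i \<le> mcbc_min n k m r"
proof (cases "mcbc_min n k m r")
  case (enat N)
  then obtain C where C: "mcbc n N k m r C" by (rule mcbc_min_enatE)
  show ?thesis unfolding enat
  proof (rule mcbc_minI[of m C])
    fix q assume q: "size q = k" "set_mset q \<subseteq> {1..n}" "\<And>x. count q x \<le> i"
    have "count q x \<le> r" for x using q(3)[of x] assms by linarith
    then show "\<exists>D. (\<forall>j\<in>{1..m}. D j \<subseteq> C j \<and> card (D j) \<le> 1) \<and> q \<subseteq># (\<Sum>j\<in>{1..m}. mset_set (D j))"
      by (rule mcbc_serve[OF C q(1,2)])
  qed (use mcbc_servers[OF C] mcbc_size[OF C] in auto)
qed simp

section \<open>Copies of items and the comparison (iii)\<close>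

text \<open>Items are numbered from 1, and the copies of item \<open>i\<close> form the block from
  \<open>(i - 1) * r + 1\<close> to \<open>i * r\<close>. Since natural subtraction gives
  \<open>copy_of r 0 = 1\<close>, the fibres below carry the condition
  \<open>x \<ge> 1\<close>.\<close>

definition copy_of :: "nat \<Rightarrow> nat \<Rightarrow> nat" where
  "copy_of r x = (x - 1) div r + 1"

text \<open>The remainder is the position inside the block, so \<open>c\<close> selects the first
  \<open>c\<close> copies of \<open>i\<close>: all of them for \<open>c = r\<close>, the requested
  ones for \<open>c = count q i\<close>.\<close>

lemma copy_of_fiber:
  assumes "i \<ge> 1" "c \<le> r"
  shows "{x. x \<ge> 1 \<and> copy_of r x = i \<and> (x - 1) mod r < c} = (\<lambda>t. (i - 1) * r + t + 1) ` {..<c}"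
proof (intro equalityI subsetI)
  fix x assume "x \<in> {x. x \<ge> 1 \<and> copy_of r x = i \<and> (x - 1) mod r < c}"
  then have x: "x \<ge> 1" "(x - 1) div r = i - 1" "(x - 1) mod r < c" by (auto simp: copy_of_def)
  have "x = (i - 1) * r + (x - 1) mod r + 1"
    using div_mult_mod_eq[of "x - 1" r] x(1) unfolding x(2) by linarith
  with x(3) show "x \<in> (\<lambda>t. (i - 1) * r + t + 1) ` {..<c}" by blast
qed (use assms in \<open>auto simp: copy_of_def\<close>)

lemma copy_of_le:
  assumes "x \<in> {1..r * n}"
  shows "copy_of r x \<in> {1..n}"
proof -
  have "(x - 1) div r < n"
    using assms by (intro less_mult_imp_div_less) (auto simp: mult.commute)
  then show ?thesis by (simp add: copy_of_def)
qed

lemma le_of_copy_of_le: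
  assumes "copy_of r x \<le> n" "r \<ge> 1"
  shows "x \<le> r * n"
proof -
  have "(x - 1) div r < n" using assms(1) by (simp add: copy_of_def)
  then have "x - 1 < n * r" using assms(2) by (simp add: div_less_iff_less_mult)
  then show ?thesis by (simp add: mult.commute)
qed

lemma card_copies:
  assumes "i \<ge> 1" "r \<ge> 1"
  shows "finite {x. x \<ge> 1 \<and> copy_of r x = i}" "card {x. x \<ge> 1 \<and> copy_of r x = i} = r"
proof -
  have "{x. x \<ge> 1 \<and> copy_of r x = i} = {x. x \<ge> 1 \<and> copy_of r x = i \<and> (x - 1) mod r < r}"
    using assms(2) by auto
  also have "\<dots> = (\<lambda>t. (i - 1) * r + t + 1) ` {..<r}" by (rule copy_of_fiber) (use assms in auto)
  finally have *: "{x. x \<ge> 1 \<and> copy_of r x = i} = (\<lambda>t. (i - 1) * r + t + 1) ` {..<r}" .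
  show "finite {x. x \<ge> 1 \<and> copy_of r x = i}" "card {x. x \<ge> 1 \<and> copy_of r x = i} = r"
    unfolding * by (auto simp: card_image inj_on_def)
qed

lemma count_image_mset_set:
  assumes "finite S"
  shows "count (image_mset g (mset_set S)) i = card {x \<in> S. g x = i}"
proof -
  have "{x \<in> S. i = g x} = {x \<in> S. g x = i}" by auto
  then show ?thesis using assms by (simp add: count_image_mset')
qed

lemma lift_request:
  assumes "set_mset q \<subseteq> {1..n}" "\<And>i. count q i \<le> r" "r \<ge> 1"
  obtains S where "S \<subseteq> {1..r * n}" "image_mset (copy_of r) (mset_set S) = q"
proof -
  \<comment> \<open>From each block \<open>S\<close> takes an initial segment whose length is the
    requested multiplicity.\<close>
  define S where "S = {x \<in> {1..r * n}. (x - 1) mod r < count q (copy_of r x)}"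
  have "count (image_mset (copy_of r) (mset_set S)) i = count q i" for i
  proof (cases "i \<in> {1..n}")
    case True
    have "count (image_mset (copy_of r) (mset_set S)) i = card {x \<in> S. copy_of r x = i}"
      by (rule count_image_mset_set) (simp add: S_def)
    also have "{x \<in> S. copy_of r x = i} = {x. x \<ge> 1 \<and> copy_of r x = i \<and> (x - 1) mod r < count q i}"
      using True assms(3) le_of_copy_of_le by (auto simp: S_def)
    also have "\<dots> = (\<lambda>t. (i - 1) * r + t + 1) ` {..<count q i}"
      using True assms(2) by (intro copy_of_fiber) auto
    also have "card \<dots> = count q i" by (simp add: card_image inj_on_def)
    finally show ?thesis .
  next
    case False
    then have "count q i = 0" using assms(1) by (auto simp: not_in_iff[symmetric])
    moreover have "i \<notin># image_mset (copy_of r) (mset_set S)"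
      using False copy_of_le by (auto simp: S_def)
    ultimately show ?thesis unfolding not_in_iff by simp
  qed
  then have "image_mset (copy_of r) (mset_set S) = q" by (simp add: multiset_eq_iff)
  moreover have "S \<subseteq> {1..r * n}" by (auto simp: S_def)
  ultimately show thesis using that by blast
qed

lemma image_mset_sum:
  "finite J \<Longrightarrow> image_mset g (\<Sum>j\<in>J. F j) = (\<Sum>j\<in>J. image_mset g (F j))"
  by (induction J rule: finite_induct) auto

lemma image_mset_mset_set_card_le_1:
  assumes "card D \<le> 1" "finite D"
  shows "image_mset g (mset_set D) = mset_set (g ` D)"
  using assms by (intro image_mset_mset_set) (auto simp: card_le_Suc0_iff_eq inj_on_def)

text \<open>Identifying the copies of an item on every server cannot increase storage. A request
  lifts to a set of distinct copies, and the service of that set projects back to one for the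
  request.\<close>

lemma mcbc_min_le_cbc_min:
  assumes "r \<ge> 1"
  shows "mcbc_min n k m r \<le> cbc_min (r * n) k m"
proof (cases "cbc_min (r * n) k m")
  case (enat N)
  then obtain C where C: "mcbc (r * n) N k m 1 C" by (rule mcbc_min_enatE)
  have finC: "finite (C j)" if "j \<in> {1..m}" for j
    using mcbc_servers[OF C that] by (rule finite_subset) simp
  show ?thesis unfolding enat
  proof (rule mcbc_minI[of m "\<lambda>j. copy_of r ` C j"])
    show "copy_of r ` C j \<subseteq> {1..n}" if "j \<in> {1..m}" for j
      using mcbc_servers[OF C that] copy_of_le by blast
    have "(\<Sum>j\<in>{1..m}. card (copy_of r ` C j)) \<le> (\<Sum>j\<in>{1..m}. card (C j))"
      using finC by (intro sum_mono card_image_le)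
    then show "(\<Sum>j\<in>{1..m}. card (copy_of r ` C j)) \<le> N" using mcbc_size[OF C] by simp
    fix q assume q: "size q = k" "set_mset q \<subseteq> {1..n}" "\<And>i. count q i \<le> r"
    obtain S where S: "S \<subseteq> {1..r * n}" "image_mset (copy_of r) (mset_set S) = q"
      using lift_request[OF q(2,3) assms] by blast
    have "finite S" using S(1) finite_subset by blast
    then have S': "size (mset_set S) = k" "set_mset (mset_set S) \<subseteq> {1..r * n}"
      "count (mset_set S) i \<le> 1" for i
      using S q(1) by (auto simp: count_mset_set')
    obtain D where D: "\<And>j. j \<in> {1..m} \<Longrightarrow> D j \<subseteq> C j" "\<And>j. j \<in> {1..m} \<Longrightarrow> card (D j) \<le> 1"
      "mset_set S \<subseteq># (\<Sum>j\<in>{1..m}. mset_set (D j))"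
      using mcbc_serve[OF C S'] by blast
    have fin: "finite (D j)" if "j \<in> {1..m}" for j
      using D(1)[OF that] finC[OF that] by (rule finite_subset)
    have "q \<subseteq># image_mset (copy_of r) (\<Sum>j\<in>{1..m}. mset_set (D j))"
      unfolding S(2)[symmetric] using D(3) by (rule image_mset_subseteq_mono)
    also have "\<dots> = (\<Sum>j\<in>{1..m}. mset_set (copy_of r ` D j))"
      unfolding image_mset_sum[OF finite_atLeastAtMost] using D(2) fin
      by (intro sum.cong refl image_mset_mset_set_card_le_1)
    finally have "q \<subseteq># (\<Sum>j\<in>{1..m}. mset_set (copy_of r ` D j))" .
    moreover have "card (copy_of r ` D j) \<le> 1" if "j \<in> {1..m}" for j
      using D(2)[OF that] card_image_le[OF fin[OF that], of "copy_of r"] by linarith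
    moreover have "copy_of r ` D j \<subseteq> copy_of r ` C j" if "j \<in> {1..m}" for j
      using D(1)[OF that] by (rule image_mono)
    ultimately show "\<exists>D. (\<forall>j\<in>{1..m}. D j \<subseteq> copy_of r ` C j \<and> card (D j) \<le> 1) \<and>
        q \<subseteq># (\<Sum>j\<in>{1..m}. mset_set (D j))"
      by (intro exI[of _ "\<lambda>j. copy_of r ` D j"] conjI ballI)
  qed
qed simp

text \<open>Greedy assignment, one server at a time: if server \<open>j\<close> hands out the image
  of some \<open>x\<close> still in \<open>Q\<close>, it is given \<open>x\<close>, which is then
  removed from \<open>Q\<close>; otherwise it is given nothing.\<close>

lemma lift_service:
  assumes "finite J" "\<And>j. j \<in> J \<Longrightarrow> card (D j) \<le> 1" "\<And>j. j \<in> J \<Longrightarrow> finite (D j)"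
    and "image_mset g Q \<subseteq># (\<Sum>j\<in>J. mset_set (D j))"
  shows "\<exists>D'. (\<forall>j\<in>J. D' j \<subseteq> set_mset Q \<and> g ` D' j \<subseteq> D j \<and> card (D' j) \<le> 1) \<and>
    Q \<subseteq># (\<Sum>j\<in>J. mset_set (D' j))"
  using assms
proof (induction J arbitrary: Q rule: finite_induct)
  case (insert j J)
  show ?case
  proof (cases "\<exists>x\<in>#Q. g x \<in> D j")
    case True
    then obtain x where x: "x \<in># Q" "g x \<in> D j" by blast
    have "card (D j) \<le> Suc 0" using insert.prems(1)[of j] by simp
    with x(2) insert.prems(2)[of j] have Dj: "D j = {g x}" by (auto simp: card_le_Suc0_iff_eq)
    obtain P where P: "Q = add_mset x P" using x(1) by (metis insert_DiffM)
    have "image_mset g P \<subseteq># (\<Sum>j\<in>J. mset_set (D j))"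
      using insert.prems(3) insert.hyps Dj P by simp
    then obtain D' where D': "\<forall>j\<in>J. D' j \<subseteq> set_mset P \<and> g ` D' j \<subseteq> D j \<and> card (D' j) \<le> 1"
      "P \<subseteq># (\<Sum>j\<in>J. mset_set (D' j))"
      using insert.IH[of P] insert.prems by auto
    have "(\<Sum>i\<in>J. mset_set ((D'(j := {x})) i)) = (\<Sum>i\<in>J. mset_set (D' i))"
      using insert.hyps by (intro sum.cong) auto
    then show ?thesis
      using D' insert.hyps P Dj by (intro exI[of _ "D'(j := {x})"]) auto
  next
    case False
    \<comment> \<open>No element of \<open>Q\<close> maps into \<open>D j\<close>, so dropping
      server \<open>j\<close> only lowers counts of elements outside the projected request.\<close>
    have "image_mset g Q \<subseteq># (\<Sum>j\<in>J. mset_set (D j))"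
    proof (rule mset_subset_eqI)
      fix y
      show "count (image_mset g Q) y \<le> count (\<Sum>j\<in>J. mset_set (D j)) y"
      proof (cases "y \<in> D j")
        case True
        then have "y \<notin># image_mset g Q" using False by auto
        then show ?thesis unfolding not_in_iff by simp
      next
        case False
        then show ?thesis
          using mset_subset_eq_count[OF insert.prems(3), of y] insert.hyps by simp
      qed
    qed
    then obtain D' where D': "\<forall>j\<in>J. D' j \<subseteq> set_mset Q \<and> g ` D' j \<subseteq> D j \<and> card (D' j) \<le> 1"
      "Q \<subseteq># (\<Sum>j\<in>J. mset_set (D' j))"
      using insert.IH[of Q] insert.prems by auto
    have "(\<Sum>i\<in>J. mset_set ((D'(j := {})) i)) = (\<Sum>i\<in>J. mset_set (D' i))"
      using insert.hyps by (intro sum.cong) auto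
    then show ?thesis
      using D' insert.hyps by (intro exI[of _ "D'(j := {})"]) auto
  qed
qed simp

text \<open>Storing all \<open>r\<close> copies in place of each item multiplies storage by
  \<open>r\<close>. A set of copies projects to a request with multiplicities at most
  \<open>r\<close>, whose service is lifted by \<open>lift_service\<close>.\<close>

lemma cbc_min_le_mcbc_min:
  assumes "r \<ge> 1"
  shows "cbc_min (r * n) k m \<le> enat r * mcbc_min n k m r"
proof (cases "mcbc_min n k m r")
  case (enat N)
  then obtain C where C: "mcbc n N k m r C" by (rule mcbc_min_enatE)
  define C' where "C' j = {x. x \<ge> 1 \<and> copy_of r x \<in> C j}" for j
  have finC: "finite (C j)" if "j \<in> {1..m}" for j
    using mcbc_servers[OF C that] by (rule finite_subset) simp
  have "cbc_min (r * n) k m \<le> enat (r * N)"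
  proof (rule mcbc_minI[of m C'])
    show "C' j \<subseteq> {1..r * n}" if "j \<in> {1..m}" for j
      using mcbc_servers[OF C that] le_of_copy_of_le[OF _ assms] by (fastforce simp: C'_def)
    have "card (C' j) \<le> r * card (C j)" if j: "j \<in> {1..m}" for j
    proof -
      have "C' j = (\<Union>i\<in>C j. {x. x \<ge> 1 \<and> copy_of r x = i})" by (auto simp: C'_def)
      then have "card (C' j) \<le> (\<Sum>i\<in>C j. card {x. x \<ge> 1 \<and> copy_of r x = i})"
        by (simp only: card_UN_le[OF finC[OF j]])
      also have "\<dots> = (\<Sum>i\<in>C j. r)"
        using mcbc_servers[OF C j] assms by (intro sum.cong refl card_copies) auto
      finally show ?thesis by (simp add: mult.commute)
    qed
    then have "(\<Sum>j\<in>{1..m}. card (C' j)) \<le> (\<Sum>j\<in>{1..m}. r * card (C j))" by (rule sum_mono)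
    then show "(\<Sum>j\<in>{1..m}. card (C' j)) \<le> r * N"
      using mcbc_size[OF C] by (simp add: sum_distrib_left)
    fix Q assume Q: "size Q = k" "set_mset Q \<subseteq> {1..r * n}" "\<And>x. count Q x \<le> 1"
    define S where "S = set_mset Q"
    have QS: "Q = mset_set S"
    proof (rule multiset_eqI)
      fix x show "count Q x = count (mset_set S) x"
        using Q(3)[of x] by (cases "x \<in># Q") (auto simp: S_def count_mset_set' le_Suc_eq simp flip: count_greater_zero_iff)
    qed
    have cnt: "count (image_mset (copy_of r) Q) i \<le> r" for i
    proof (cases "i \<ge> 1")
      case True
      have "count (image_mset (copy_of r) Q) i = card {x \<in> S. copy_of r x = i}"
        unfolding QS by (rule count_image_mset_set) (simp add: S_def)
      also have "\<dots> \<le> card {x. x \<ge> 1 \<and> copy_of r x = i}"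
        using Q(2) by (intro card_mono card_copies True assms) (auto simp: S_def)
      also have "\<dots> = r" by (intro card_copies True assms)
      finally show ?thesis .
    next
      case False
      then have "i \<notin># image_mset (copy_of r) Q" by (auto simp: copy_of_def)
      then show ?thesis unfolding not_in_iff by simp
    qed
    have img: "size (image_mset (copy_of r) Q) = k" "set_mset (image_mset (copy_of r) Q) \<subseteq> {1..n}"
      using Q(1,2) copy_of_le[of _ r n] by auto
    obtain D where D: "\<And>j. j \<in> {1..m} \<Longrightarrow> D j \<subseteq> C j"
      "\<And>j. j \<in> {1..m} \<Longrightarrow> card (D j) \<le> 1"
      "image_mset (copy_of r) Q \<subseteq># (\<Sum>j\<in>{1..m}. mset_set (D j))"
      using mcbc_serve[OF C img cnt] by blast
    have "finite (D j)" if "j \<in> {1..m}" for j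
      using D(1)[OF that] finC[OF that] by (rule finite_subset)
    then obtain D' where "\<forall>j\<in>{1..m}. D' j \<subseteq> set_mset Q \<and> copy_of r ` D' j \<subseteq> D j \<and> card (D' j) \<le> 1"
      "Q \<subseteq># (\<Sum>j\<in>{1..m}. mset_set (D' j))"
      using lift_service[OF _ D(2) _ D(3)] by auto
    then show "\<exists>D. (\<forall>j\<in>{1..m}. D j \<subseteq> C' j \<and> card (D j) \<le> 1) \<and> Q \<subseteq># (\<Sum>j\<in>{1..m}. mset_set (D j))"
      using D(1) Q(2) by (intro exI[of _ D']) (fastforce simp: C'_def)
  qed
  then show ?thesis by (simp add: enat)
\<comment> \<open>For an infinite minimum \<open>r \<ge> 1\<close> matters, since zero times
  infinity is zero in \<open>enat\<close>.\<close>
qed (use assms in \<open>simp add: enat_0_iff\<close>)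

section \<open>Splitting requests over blocks of servers, (iv)\<close>

text \<open>Induction on \<open>r\<close>, peeling off one set per step. That set must contain every
  item of full multiplicity, and at most \<open>r * K\<close> copies may remain after it. At most
  \<open>K\<close> items have full multiplicity, because the total size is at most
  \<open>Suc r * K\<close>.\<close>

lemma split_request:
  assumes "\<And>i. count q i \<le> r" "size q \<le> r * K"
  obtains S where "\<And>t. t < r \<Longrightarrow> finite (S t)" "\<And>t. t < r \<Longrightarrow> S t \<subseteq> set_mset q"
    "\<And>t. t < r \<Longrightarrow> card (S t) \<le> K" "q = (\<Sum>t<r. mset_set (S t))"
  using assms
proof (induction r arbitrary: q thesis)
  case 0
  then show ?case by (simp add: multiset_eq_iff)
next
  case (Suc r)
  \<comment> \<open>The items that the next set must contain for the remaining multiplicities to drop to \<open>r\<close>.\<close>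
  define F where "F = {i \<in> set_mset q. count q i = Suc r}"
  have cardF: "card F \<le> K"
  proof -
    have "Suc r * card F = (\<Sum>i\<in>F. count q i)" by (simp add: F_def)
    also have "\<dots> \<le> (\<Sum>i\<in>set_mset q. count q i)" by (intro sum_mono2) (auto simp: F_def)
    also have "\<dots> = size q" by (simp add: size_multiset_overloaded_eq)
    finally have "Suc r * card F \<le> Suc r * K" using Suc.prems(3) by linarith
    then show ?thesis by (simp only: Suc_mult_le_cancel1)
  qed
  have "\<exists>S. F \<subseteq> S \<and> S \<subseteq> set_mset q \<and> card S \<le> K \<and> size (q - mset_set S) \<le> r * K"
  proof (cases "K \<le> card (set_mset q)")
    case True
    \<comment> \<open>With at least \<open>K\<close> distinct items available, \<open>F\<close> is
      enlarged to exactly \<open>K\<close> of them, so \<open>K\<close> copies disappear.\<close>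
    then obtain S where S: "F \<subseteq> S" "S \<subseteq> set_mset q" "card S = K"
      using exists_subset_between[OF cardF True] by (auto simp: F_def)
    have "finite S" using S(2) finite_subset by blast
    have "mset_set S \<subseteq># q"
      by (meson S(2) finite_set_mset mset_set_set_mset_msubset subset_imp_msubset_mset_set subset_mset.order_trans)
    then have "size (q - mset_set S) \<le> r * K"
      using S(3) Suc.prems(3) by (simp add: size_Diff_submset)
    with S show ?thesis by auto
  next
    case False
    \<comment> \<open>With fewer than \<open>K\<close> distinct items, one copy of each is removed;
      every item then keeps at most \<open>r\<close> copies.\<close>
    have "size (q - mset_set (set_mset q)) = (\<Sum>i\<in>set_mset (q - mset_set (set_mset q)). count (q - mset_set (set_mset q)) i)"
      by (simp add: size_multiset_overloaded_eq)
    also have "\<dots> \<le> (\<Sum>i\<in>set_mset q. count (q - mset_set (set_mset q)) i)"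
      by (intro sum_mono2) (auto dest: in_diffD)
    also have "\<dots> \<le> (\<Sum>i\<in>set_mset q. r)"
      using Suc.prems(2) by (intro sum_mono) (auto simp: le_diff_conv)
    also have "\<dots> \<le> r * K" using False by simp
    finally show ?thesis using False by (intro exI[of _ "set_mset q"]) (auto simp: F_def)
  qed
  then obtain S0 where S0: "F \<subseteq> S0" "S0 \<subseteq> set_mset q" "card S0 \<le> K" "size (q - mset_set S0) \<le> r * K"
    by blast
  have fin: "finite S0" using S0(2) finite_subset by blast
  have sub: "mset_set S0 \<subseteq># q"
    by (meson S0(2) finite_set_mset mset_set_set_mset_msubset subset_imp_msubset_mset_set subset_mset.order_trans)
  have "count (q - mset_set S0) i \<le> r" for i
  proof (cases "i \<in> S0")
    case True
    then show ?thesis using Suc.prems(2)[of i] fin by simp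
  next
    case False
    then have "i \<notin> F" using S0(1) by blast
    then have "count q i \<noteq> Suc r" unfolding F_def
      by (metis (mono_tags) count_eq_zero_iff mem_Collect_eq nat.distinct(1))
    then show ?thesis using Suc.prems(2)[of i] by simp
  qed
  then obtain S where S: "\<And>t. t < r \<Longrightarrow> finite (S t)" "\<And>t. t < r \<Longrightarrow> S t \<subseteq> set_mset (q - mset_set S0)"
    "\<And>t. t < r \<Longrightarrow> card (S t) \<le> K" "q - mset_set S0 = (\<Sum>t<r. mset_set (S t))"
    using Suc.IH[of "q - mset_set S0"] S0(4) by blast
  have "q = (q - mset_set S0) + mset_set S0" using sub by simp
  also have "\<dots> = (\<Sum>t<Suc r. mset_set ((S(r := S0)) t))" using S(4) by simp
  finally have "q = (\<Sum>t<Suc r. mset_set ((S(r := S0)) t))" .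
  moreover have "finite ((S(r := S0)) t) \<and> (S(r := S0)) t \<subseteq> set_mset q \<and> card ((S(r := S0)) t) \<le> K"
    if "t < Suc r" for t
  proof (cases "t = r")
    case True
    then show ?thesis using S0 fin by simp
  next
    case False
    then have "t < r" using that by simp
    moreover have "set_mset (q - mset_set S0) \<subseteq> set_mset q" by (auto dest: in_diffD)
    ultimately show ?thesis using S(1)[of t] order_trans[OF S(2)[of t]] S(3)[of t] False by simp
  qed
  ultimately show ?case by (intro Suc.prems(1)[of "S(r := S0)"]) blast+
qed

text \<open>A code only promises to serve requests of size exactly \<open>k\<close>, so a smaller
  set is first padded; \<open>k \<le> n\<close> leaves room for that.\<close>

lemma cbc_serve_le:
  assumes C: "mcbc n N k m 1 C" and "S \<subseteq> {1..n}" "card S \<le> k" "k \<le> n"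
  obtains D where "\<And>j. j \<in> {1..m} \<Longrightarrow> D j \<subseteq> C j" "\<And>j. j \<in> {1..m} \<Longrightarrow> card (D j) \<le> 1"
    "mset_set S \<subseteq># (\<Sum>j\<in>{1..m}. mset_set (D j))"
proof -
  obtain S' where S': "S \<subseteq> S'" "S' \<subseteq> {1..n}" "card S' = k"
    using exists_subset_between[of S k "{1..n}"] assms by auto
  have fin: "finite S'" using S'(2) finite_subset by blast
  then have sub: "mset_set S \<subseteq># mset_set S'" by (rule subset_imp_msubset_mset_set[OF S'(1)])
  have req: "size (mset_set S') = k" "set_mset (mset_set S') \<subseteq> {1..n}" "count (mset_set S') i \<le> 1" for i
    using S' fin by (auto simp: count_mset_set')
  obtain D where D: "\<And>j. j \<in> {1..m} \<Longrightarrow> D j \<subseteq> C j" "\<And>j. j \<in> {1..m} \<Longrightarrow> card (D j) \<le> 1"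
    "mset_set S' \<subseteq># (\<Sum>j\<in>{1..m}. mset_set (D j))"
    using mcbc_serve[OF C req] by blast
  then show thesis using that[of D] sub by (meson subset_mset.order_trans)
qed

text \<open>Server \<open>j\<close>, counted from 1, is number \<open>(j - 1) mod p + 1\<close> in
  block \<open>(j - 1) div p\<close>, with blocks counted from 0. The general codomain covers both
  storage sizes and multisets of served items.\<close>

lemma sum_blocks:
  fixes f :: "nat \<Rightarrow> nat \<Rightarrow> 'a::comm_monoid_add"
  assumes "p \<ge> 1"
  shows "(\<Sum>j\<in>{1..r * p}. f ((j - 1) div p) ((j - 1) mod p + 1)) = (\<Sum>t<r. \<Sum>s\<in>{1..p}. f t s)"
proof -
  have "(\<Sum>j\<in>{1..r * p}. f ((j - 1) div p) ((j - 1) mod p + 1)) = (\<Sum>j<r * p. f (j div p) (j mod p + 1))"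
    by (rule sum.reindex_bij_witness[of _ Suc "\<lambda>j. j - 1"]) auto
  also have "\<dots> = (\<Sum>t<r. \<Sum>j\<in>{t * p..<t * p + p}. f (j div p) (j mod p + 1))"
    by (rule sum.nat_group[symmetric])
  also have "\<dots> = (\<Sum>t<r. \<Sum>s\<in>{1..p}. f t s)"
  proof (rule sum.cong[OF refl])
    fix t
    have "j div p = t \<and> j mod p = j - t * p" if "t * p \<le> j" "j < t * p + p" for j
    proof -
      have "j div p = t" using that by (intro div_nat_eqI) (auto simp: mult.commute)
      then show ?thesis by (simp add: modulo_nat_def)
    qed
    then show "(\<Sum>j\<in>{t * p..<t * p + p}. f (j div p) (j mod p + 1)) = (\<Sum>s\<in>{1..p}. f t s)"
      by (intro sum.reindex_bij_witness[where i = "\<lambda>s. t * p + (s - 1)" and j = "\<lambda>j. j - t * p + 1"])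
        (use assms in auto)
  qed
  finally show ?thesis .
qed

lemma sum_subset_mset_mono:
  fixes A B :: "nat \<Rightarrow> 'a multiset"
  assumes "\<And>t. t < r \<Longrightarrow> A t \<subseteq># B t"
  shows "(\<Sum>t<r. A t) \<subseteq># (\<Sum>t<r. B t)"
  using assms by (induction r) (auto intro: subset_mset.add_mono)

text \<open>The small code is repeated on \<open>r\<close> blocks of \<open>p\<close> servers, and
  any further servers stay empty. \<open>K \<le> n\<close> is asked for only if
  \<open>k \<le> r * n\<close>; otherwise there is no admissible request and the minimum is
  0.\<close>

lemma mcbc_min_le_mult_cbc_min:
  assumes "r \<ge> 1" "p \<ge> 1" "r * p \<le> m" "k \<le> r * K" "k \<le> r * n \<Longrightarrow> K \<le> n"
  shows "mcbc_min n k m r \<le> enat r * cbc_min n K p"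
proof (cases "cbc_min n K p")
  case (enat N)
  then obtain C where C: "mcbc n N K p 1 C" by (rule mcbc_min_enatE)
  show ?thesis
  proof (cases "k \<le> r * n")
    case True
    define C' where "C' j = (if j \<le> r * p then C ((j - 1) mod p + 1) else {})" for j
    have idx: "(j - 1) mod p + 1 \<in> {1..p}" for j using assms(2) by (simp add: Suc_leI)
    have "mcbc_min n k m r \<le> enat (r * N)"
    proof (rule mcbc_minI[of m C'])
      show "C' j \<subseteq> {1..n}" for j using mcbc_servers[OF C idx[of j]] by (simp add: C'_def)
      have "(\<Sum>j\<in>{1..m}. card (C' j)) = (\<Sum>j\<in>{1..r * p}. card (C ((j - 1) mod p + 1)))"
        using assms(3) by (intro sum.mono_neutral_cong_right) (auto simp: C'_def)
      also have "\<dots> = r * N"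
        using sum_blocks[OF assms(2), where r = r and f = "\<lambda>_ s. card (C s)"] mcbc_size[OF C] by simp
      finally show "(\<Sum>j\<in>{1..m}. card (C' j)) \<le> r * N" by simp
      fix q assume q: "size q = k" "set_mset q \<subseteq> {1..n}" "\<And>i. count q i \<le> r"
      obtain S where S: "\<And>t. t < r \<Longrightarrow> S t \<subseteq> set_mset q"
        "\<And>t. t < r \<Longrightarrow> card (S t) \<le> K" "q = (\<Sum>t<r. mset_set (S t))"
        using split_request[of q r K] q assms(4) by metis
      have "\<exists>D. (\<forall>j\<in>{1..p}. D j \<subseteq> C j \<and> card (D j) \<le> 1) \<and>
          mset_set (S t) \<subseteq># (\<Sum>j\<in>{1..p}. mset_set (D j))" if "t < r" for t
        using cbc_serve_le[OF C _ S(2)[OF that] assms(5)[OF True]] S(1)[OF that] q(2)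
        by (metis order_trans)
      then obtain E where E: "\<And>t j. t < r \<Longrightarrow> j \<in> {1..p} \<Longrightarrow> E t j \<subseteq> C j \<and> card (E t j) \<le> 1"
        "\<And>t. t < r \<Longrightarrow> mset_set (S t) \<subseteq># (\<Sum>j\<in>{1..p}. mset_set (E t j))"
        by metis
      \<comment> \<open>Block \<open>t\<close> serves the \<open>t\<close>-th set of the split
        request.\<close>
      define D where "D j = (if j \<le> r * p then E ((j - 1) div p) ((j - 1) mod p + 1) else {})" for j
      have "D j \<subseteq> C' j \<and> card (D j) \<le> 1" if "j \<in> {1..m}" for j
      proof (cases "j \<le> r * p")
        case True
        then have "(j - 1) div p < r" using that by (intro less_mult_imp_div_less) auto
        then show ?thesis using E(1)[OF _ idx] True by (simp add: D_def C'_def)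
      qed (simp add: D_def)
      moreover have "q \<subseteq># (\<Sum>j\<in>{1..m}. mset_set (D j))"
      proof -
        have "q \<subseteq># (\<Sum>t<r. \<Sum>j\<in>{1..p}. mset_set (E t j))"
          unfolding S(3) using E(2) by (rule sum_subset_mset_mono)
        also have "\<dots> = (\<Sum>j\<in>{1..r * p}. mset_set (E ((j - 1) div p) ((j - 1) mod p + 1)))"
          by (rule sum_blocks[OF assms(2), symmetric])
        also have "\<dots> = (\<Sum>j\<in>{1..m}. mset_set (D j))"
          using assms(3) by (intro sum.mono_neutral_cong_left) (auto simp: D_def)
        finally show ?thesis .
      qed
      ultimately show "\<exists>D. (\<forall>j\<in>{1..m}. D j \<subseteq> C' j \<and> card (D j) \<le> 1) \<and>
          q \<subseteq># (\<Sum>j\<in>{1..m}. mset_set (D j))" by blast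
    qed
    then show ?thesis unfolding enat by simp
  qed (simp add: mcbc_min_degenerate)
qed (use assms in \<open>simp add: enat_0_iff\<close>)

section \<open>Convexity and double counting for (v)\<close>

lemma card_supersets_of_size:
  assumes "finite M" "B \<subseteq> M" "card B \<le> p"
  shows "card {X. X \<subseteq> M \<and> card X = p \<and> B \<subseteq> X} = (card M - card B) choose (p - card B)"
proof -
  have finB: "finite B" using assms finite_subset by blast
  have "bij_betw (\<lambda>Y. B \<union> Y) {Y. Y \<subseteq> M - B \<and> card Y = p - card B} {X. X \<subseteq> M \<and> card X = p \<and> B \<subseteq> X}"
  proof (rule bij_betw_byWitness[of _ "\<lambda>X. X - B"])
    show "(\<union>) B ` {Y. Y \<subseteq> M - B \<and> card Y = p - card B} \<subseteq> {X. X \<subseteq> M \<and> card X = p \<and> B \<subseteq> X}"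
    proof
      fix X assume "X \<in> (\<union>) B ` {Y. Y \<subseteq> M - B \<and> card Y = p - card B}"
      then obtain Y where Y: "X = B \<union> Y" "Y \<subseteq> M - B" "card Y = p - card B" by blast
      then have "finite Y" using assms(1) finite_subset by blast
      then have "card X = p" using Y finB assms(3) by (subst Y(1), subst card_Un_disjoint) auto
      then show "X \<in> {X. X \<subseteq> M \<and> card X = p \<and> B \<subseteq> X}" using Y assms(2) by auto
    qed
  qed (auto simp: card_Diff_subset[OF finB])
  then have "card {X. X \<subseteq> M \<and> card X = p \<and> B \<subseteq> X} = card {Y. Y \<subseteq> M - B \<and> card Y = p - card B}"
    by (rule bij_betw_same_card[THEN sym])
  also have "\<dots> = card (M - B) choose (p - card B)" using assms(1) by (simp add: n_subsets)
  finally show ?thesis by (simp add: card_Diff_subset[OF finB assms(2)])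
qed

text \<open>
  The slope is \<open>f (j + 1) - f j\<close> for \<open>f i = (a + i) choose i\<close>; multiplying by \<open>Suc j\<close> clears the
  denominator, as \<open>(j + 1) * (f (j + 1) - f j) = f j * a\<close>.
\<close>
lemma binomial_tangent:
  fixes a x j :: nat
  shows "real (Suc j) * real ((a + x) choose x) \<ge>
    real ((a + j) choose j) * (real (Suc j) + (real x - real j) * real a)"
proof (cases a)
  case (Suc b)
  define f where "f i = real ((a + i) choose i)" for i
  define \<Delta> where "\<Delta> i = real ((a + i) choose Suc i)" for i
  have step: "f (Suc i) = f i + \<Delta> i" for i by (simp add: f_def \<Delta>_def)
  \<comment> \<open>Discrete convexity: by Pascal's rule consecutive increments differ by a binomial
    coefficient.\<close>
  have mono: "\<Delta> i \<le> \<Delta> (Suc i)" for i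
  proof -
    have "a + Suc i choose Suc (Suc i) = (a + i choose Suc i) + (a + i choose Suc (Suc i))" by simp
    then show ?thesis by (simp add: \<Delta>_def)
  qed
  have mono': "\<Delta> i \<le> \<Delta> i'" if "i \<le> i'" for i i' using lift_Suc_mono_le[of \<Delta>, OF mono that] .
  have up: "f (j + d) \<ge> f j + real d * \<Delta> j" for d
  proof (induction d)
    case (Suc d)
    then show ?case using step[of "j + d"] mono'[of j "j + d"] by (simp add: algebra_simps)
  qed simp
  have down: "f i \<ge> f (i + d) - real d * \<Delta> (i + d)" for i d
  proof (induction d)
    case (Suc d)
    have "real d * \<Delta> (i + d) \<le> real d * \<Delta> (i + Suc d)" by (intro mult_left_mono mono') auto
    then show ?case using Suc step[of "i + d"] mono'[of "i + d" "i + Suc d"]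
      by (simp add: algebra_simps)
  qed simp
  have tangent: "f x \<ge> f j + (real x - real j) * \<Delta> j"
  proof (cases "j \<le> x")
    case True
    then show ?thesis using up[of "x - j"] by (simp add: of_nat_diff)
  next
    case False
    then show ?thesis using down[of x "j - x"] by (simp add: of_nat_diff algebra_simps)
  qed
  \<comment> \<open>By the two absorption identities both sides equal
    \<open>(a + j) * (a + j - 1 choose j)\<close>.\<close>
  have "Suc j * (a + j choose Suc j) = (a + j choose j) * a"
    using binomial_absorb_comp[of "a + j" j] binomial_absorption[of j "a + j"]
    by (simp add: mult.commute)
  then have slope: "real (Suc j) * \<Delta> j = f j * real a" unfolding \<Delta>_def f_def by (simp only: flip: of_nat_mult)
  have "real (Suc j) * f x \<ge> real (Suc j) * (f j + (real x - real j) * \<Delta> j)"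
    using tangent by (intro mult_left_mono) auto
  also have "real (Suc j) * (f j + (real x - real j) * \<Delta> j)
      = real (Suc j) * f j + (real x - real j) * (real (Suc j) * \<Delta> j)" by (simp only: algebra_simps)
  finally show ?thesis unfolding slope by (simp add: f_def algebra_simps)
qed simp

text \<open>The supersets are counted by a binomial coefficient that is convex in
  \<open>card B\<close>; the right-hand side is its supporting line at \<open>card B = c\<close>,
  scaled by \<open>k - c\<close>.\<close>

lemma card_supersets_ge:
  assumes "finite M" "card M = m" "B \<subseteq> M" "c < k" "k \<le> m"
  shows "(real k - real c) * real (card {X. X \<subseteq> M \<and> card X = k - 1 \<and> B \<subseteq> X}) \<ge>
    real ((m - c) choose (k - 1 - c)) * ((real k - real c) - (real (card B) - real c) * (real m - real k + 1))"
proof (cases "card B < k")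
  case True
  \<comment> \<open>With \<open>a = m - k + 1\<close>, \<open>x = k - 1 - card B\<close> and
    \<open>j = k - 1 - c\<close>, the sum \<open>a + x\<close> is \<open>m - card B\<close> and the
    difference of \<open>x\<close> and \<open>j\<close> is \<open>c - card B\<close>.\<close>
  have "real (Suc (k - 1 - c)) * real ((m - k + 1 + (k - 1 - card B)) choose (k - 1 - card B)) \<ge>
    real ((m - k + 1 + (k - 1 - c)) choose (k - 1 - c)) *
      (real (Suc (k - 1 - c)) + (real (k - 1 - card B) - real (k - 1 - c)) * real (m - k + 1))"
    by (rule binomial_tangent)
  moreover have "real (Suc (k - 1 - c)) = real k - real c" using assms(4) by (simp add: of_nat_diff)
  moreover have "real (k - 1 - card B) - real (k - 1 - c) = - (real (card B) - real c)"
    using assms(4) True by (simp add: of_nat_diff)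
  moreover have "real (m - k + 1) = real m - real k + 1" using assms(5) by (simp add: of_nat_diff)
  moreover have "m - k + 1 + (k - 1 - card B) = m - card B" "m - k + 1 + (k - 1 - c) = m - c"
    using assms(4,5) True by auto
  moreover have "card {X. X \<subseteq> M \<and> card X = k - 1 \<and> B \<subseteq> X} = (m - card B) choose (k - 1 - card B)"
    using assms True by (subst card_supersets_of_size) auto
  ultimately show ?thesis by (simp only: mult_minus_left add_uminus_conv_diff)
next
  case False
  \<comment> \<open>For \<open>card B \<ge> k\<close> the line has already dropped to 0 or below, so
    nonnegativity of the left-hand side suffices.\<close>
  have "(real k - real c) * 1 \<le> (real (card B) - real c) * (real m - real k + 1)"
    using False assms(4,5) by (intro mult_mono) auto
  then have "real ((m - c) choose (k - 1 - c)) *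
      ((real k - real c) - (real (card B) - real c) * (real m - real k + 1)) \<le> 0"
    by (intro mult_nonneg_nonpos) auto
  also have "0 \<le> (real k - real c) * real (card {X. X \<subseteq> M \<and> card X = k - 1 \<and> B \<subseteq> X})"
    using assms(4) by simp
  finally show ?thesis .
qed

text \<open>Otherwise \<open>k\<close> copies could be requested of items stored only inside
  \<open>X\<close>, but the fewer than \<open>k\<close> servers in \<open>X\<close> hand out at most
  one item each.\<close>

lemma mcbc_confined_items:
  assumes C: "mcbc n N k m r C" and "X \<subseteq> {1..m}" "card X < k"
  shows "r * card {i \<in> {1..n}. {j \<in> {1..m}. i \<in> C j} \<subseteq> X} < k"
proof (rule ccontr)
  define T where "T = {i \<in> {1..n}. {j \<in> {1..m}. i \<in> C j} \<subseteq> X}"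
  assume "\<not> ?thesis"
  then have "k \<le> r * card T" by (simp add: T_def)
  then obtain q where q: "size q = k" "set_mset q \<subseteq> T" "\<And>i. count q i \<le> r"
    using ex_request[of T] by (auto simp: T_def)
  have qn: "set_mset q \<subseteq> {1..n}" using q(2) by (auto simp: T_def)
  obtain D where D: "\<And>j. j \<in> {1..m} \<Longrightarrow> D j \<subseteq> C j" "\<And>j. j \<in> {1..m} \<Longrightarrow> card (D j) \<le> 1"
    "q \<subseteq># (\<Sum>j\<in>{1..m}. mset_set (D j))"
    using mcbc_serve[OF C q(1) qn q(3)] by blast
  have "finite (D j)" if "j \<in> {1..m}" for j
    using order_trans[OF D(1)[OF that] mcbc_servers[OF C that]] by (rule finite_subset) simp
  then have "k \<le> card {j \<in> {1..m}. set_mset q \<inter> D j \<noteq> {}}"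
    using size_le_card_hit[OF _ D(2) _ D(3)] q(1) by simp
  also have "\<dots> \<le> card X"
  proof (rule card_mono)
    show "finite X" using assms(2) by (rule finite_subset) simp
    show "{j \<in> {1..m}. set_mset q \<inter> D j \<noteq> {}} \<subseteq> X"
    proof
      fix j assume "j \<in> {j \<in> {1..m}. set_mset q \<inter> D j \<noteq> {}}"
      then obtain i where "j \<in> {1..m}" "i \<in> T" "i \<in> C j" using D(1) q(2) by blast
      then show "j \<in> X" by (auto simp: T_def)
    qed
  qed
  finally show False using assms(3) by simp
qed

text \<open>Pairs of an item and a \<open>(k - 1)\<close>-set of servers containing all its servers
  are counted twice: from below by item, from above by server set. The result is (v) with
  denominators cleared.\<close>

lemma mcbc_counting_bound:
  assumes C: "mcbc n N k m r C" and "r \<ge> 1" "c < k" "k \<le> m"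
  shows "real ((m - c) choose (k - 1 - c)) *
      (real n * (real k - real c) - (real N - real n * real c) * (real m - real k + 1))
    \<le> (real k - real c) * (real ((k - 1) div r) * real (m choose (k - 1)))"
proof -
  define B where "B i = {j \<in> {1..m}. i \<in> C j}" for i
  define P where "P = {X. X \<subseteq> {1..m} \<and> card X = k - 1}"
  have finP: "finite P" by (rule finite_subset[of _ "Pow {1..m}"]) (auto simp: P_def)
  have cardP: "card P = m choose (k - 1)" by (simp add: P_def n_subsets)
  have N: "real N = (\<Sum>i\<in>{1..n}. real (card (B i)))"
    using sum_card_eq_sum_replication[of "{1..m}" C "{1..n}"] mcbc_servers[OF C] mcbc_size[OF C]
    by (simp add: B_def)
  \<comment> \<open>The bound per item is affine in \<open>card (B i)\<close>, so its sum over the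
    items sees the code only through \<open>N\<close>.\<close>
  have "real ((m - c) choose (k - 1 - c)) *
      (real n * (real k - real c) - (real N - real n * real c) * (real m - real k + 1))
    = (\<Sum>i\<in>{1..n}. real ((m - c) choose (k - 1 - c)) *
        ((real k - real c) - (real (card (B i)) - real c) * (real m - real k + 1)))"
    by (simp add: N sum_distrib_left[symmetric] sum_distrib_right[symmetric] sum_subtractf)
  also have "\<dots> \<le> (\<Sum>i\<in>{1..n}. (real k - real c) * real (card {X. X \<subseteq> {1..m} \<and> card X = k - 1 \<and> B i \<subseteq> X}))"
    using assms(3,4) by (intro sum_mono card_supersets_ge) (auto simp: B_def)
  also have "\<dots> = (real k - real c) * real (\<Sum>i\<in>{1..n}. card {X \<in> P. B i \<subseteq> X})"
    by (simp add: sum_distrib_left P_def conj_assoc)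
  also have "(\<Sum>i\<in>{1..n}. card {X \<in> P. B i \<subseteq> X}) = (\<Sum>X\<in>P. card {i \<in> {1..n}. B i \<subseteq> X})"
    using sum_card_eq_sum_replication[of "{1..n}" "\<lambda>i. {X \<in> P. B i \<subseteq> X}" P] finP by auto
  also have "(real k - real c) * real (\<Sum>X\<in>P. card {i \<in> {1..n}. B i \<subseteq> X})
      \<le> (real k - real c) * real (\<Sum>X\<in>P. (k - 1) div r)"
  proof (intro mult_left_mono of_nat_mono sum_mono)
    fix X assume "X \<in> P"
    then have "r * card {i \<in> {1..n}. B i \<subseteq> X} < k"
      using mcbc_confined_items[OF C, of X] assms(3) by (simp add: P_def B_def)
    then show "card {i \<in> {1..n}. B i \<subseteq> X} \<le> (k - 1) div r"
      using assms(2) by (simp add: less_eq_div_iff_mult_less_eq mult.commute)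
  qed (use assms(3) in simp)
  finally show ?thesis by (simp add: cardP mult.commute)
qed

lemma mcbc_size_ge_nc:
  assumes C: "mcbc n N k m r C" and "r \<ge> 1" "c < k" "k \<le> m"
  shows "real N \<ge> real n * real c -
    of_int \<lfloor>(real k - real c) / (real m - real k + 1) *
      (of_int \<lfloor>(real k - 1) / real r\<rfloor> * real (m choose (k - 1)) /
         real ((m - c) choose (k - 1 - c)) - real n)\<rfloor>"
proof -
  define w where "w = real ((m - c) choose (k - 1 - c))"
  define M where "M = real ((k - 1) div r) * real (m choose (k - 1))"
  define e where "e = (real k - real c) / (real m - real k + 1) * (M / w - real n)"
  have w: "w > 0" using assms(3,4) by (simp add: w_def zero_less_binomial)
  have d: "real m - real k + 1 > 0" using assms(4) by simp
  have "w * (real n * (real k - real c) - (real N - real n * real c) * (real m - real k + 1))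
    \<le> (real k - real c) * M"
    using mcbc_counting_bound[OF assms] by (simp only: w_def M_def)
  then have "real n * (real k - real c) - (real N - real n * real c) * (real m - real k + 1)
    \<le> (real k - real c) * (M / w)"
    using w by (simp add: pos_le_divide_eq mult.commute)
  then have "(real n * real c - real N) * (real m - real k + 1) \<le> (real k - real c) * (M / w - real n)"
    unfolding left_diff_distrib right_diff_distrib
      mult.commute[of "real k" "real n"] mult.commute[of "real c" "real n"] by linarith
  then have "real n * real c - real N \<le> e"
    using d by (simp add: e_def pos_le_divide_eq)
  \<comment> \<open>The left-hand side is an integer, so \<open>e\<close> may be replaced by its
    floor.\<close>
  then have "of_int (int n * int c - int N) \<le> e" by simp
  then have "int n * int c - int N \<le> \<lfloor>e\<rfloor>" by (simp only: le_floor_iff)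
  then have "real_of_int (int n * int c - int N) \<le> of_int \<lfloor>e\<rfloor>" by (simp only: of_int_le_iff)
  then have "real N \<ge> real n * real c - of_int \<lfloor>e\<rfloor>" by simp
  moreover have "\<lfloor>(real k - 1) / real r\<rfloor> = int ((k - 1) div r)"
    using floor_divide_of_nat_eq[of "k - 1" r, where ?'a = real] assms(3) by (simp add: of_nat_diff)
  ultimately show ?thesis by (simp add: e_def M_def w_def)
qed

text \<open>Claim (i) is stated for \<open>k \<le> r * n\<close>: for larger \<open>k\<close> no
  request is admissible and the minimum is 0 by \<open>mcbc_min_degenerate\<close>, while
  \<open>r * n\<close> is positive. The bounds with real quotients are compared in
  \<open>ereal\<close>, since the minimum is an \<open>enat\<close>.\<close>

theorem theorem2:
  fixes n k m r :: nat
  assumes "n \<ge> 1" and "r \<ge> 1" and "r \<le> k" and "k \<le> m"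
  shows
    "(k \<le> r * n \<longrightarrow> mcbc_min n k m r \<ge> enat (r * n)) \<and>
     (\<forall>i\<in>{1..r - 1}. mcbc_min n k m r \<ge> mcbc_min n k m i) \<and>
     (ereal (1 / real r) * ereal_of_enat (cbc_min (r * n) k m) \<le> ereal_of_enat (mcbc_min n k m r) \<and>
      mcbc_min n k m r \<le> cbc_min (r * n) k m) \<and>
     mcbc_min n k m r \<le> enat r * cbc_min n (nat \<lceil>real k / real r\<rceil>) (nat \<lfloor>real m / real r\<rfloor>) \<and>
     (r \<le> k - 1 \<longrightarrow>
       (\<forall>c\<in>{r..k - 1}.
          ereal_of_enat (mcbc_min n k m r) \<ge>
          ereal (real n * real c -
            of_int \<lfloor>(real k - real c) / (real m - real k + 1) *
              (of_int \<lfloor>(real k - 1) / real r\<rfloor> * real (m choose (k - 1)) /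
                 real ((m - c) choose (k - 1 - c)) - real n)\<rfloor>)))"
proof -
  obtain N C where min: "mcbc_min n k m r = enat N" and C: "mcbc n N k m r C"
    using mcbc_min_attained[OF assms(4)] by blast
  obtain N' where min': "cbc_min (r * n) k m = enat N'"
    using mcbc_min_attained[OF assms(4)] by blast
  have "N' \<le> r * N" using cbc_min_le_mcbc_min[OF assms(2), of n k m] unfolding min min' by simp
  then have "real N' \<le> real r * real N" by (metis of_nat_mono of_nat_mult)
  then have iii: "ereal (1 / real r) * ereal_of_enat (cbc_min (r * n) k m) \<le> ereal_of_enat (mcbc_min n k m r)"
    using assms(2) unfolding min min' by (simp add: pos_divide_le_eq mult.commute)
  have iv: "mcbc_min n k m r \<le> enat r * cbc_min n (nat \<lceil>real k / real r\<rceil>) (nat \<lfloor>real m / real r\<rfloor>)"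
  proof (rule mcbc_min_le_mult_cbc_min)
    have fl: "nat \<lfloor>real m / real r\<rfloor> = m div r" by (simp add: floor_divide_of_nat_eq)
    show "1 \<le> nat \<lfloor>real m / real r\<rfloor>" "r * nat \<lfloor>real m / real r\<rfloor> \<le> m"
      unfolding fl using assms by (simp_all add: div_greater_zero_iff Suc_le_eq)
    have "real k = real r * (real k / real r)" using assms(2) by simp
    also have "\<dots> \<le> real r * real (nat \<lceil>real k / real r\<rceil>)"
      by (intro mult_left_mono real_nat_ceiling_ge of_nat_0_le_iff)
    finally have "real k \<le> real (r * nat \<lceil>real k / real r\<rceil>)" by (simp only: of_nat_mult)
    then show "k \<le> r * nat \<lceil>real k / real r\<rceil>" by (simp only: of_nat_le_iff)
    \<comment> \<open>This discharges the conditional premise \<open>K \<le> n\<close>: dividing by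
      \<open>r\<close> gives \<open>k / r \<le> n\<close>, and \<open>n\<close> is an
      integer.\<close>
    assume "k \<le> r * n"
    then have "real k \<le> real r * real n" by (metis of_nat_mono of_nat_mult)
    then show "nat \<lceil>real k / real r\<rceil> \<le> n"
      using assms(2) by (simp add: ceiling_le_iff pos_divide_le_eq mult.commute)
  qed (use assms in auto)
  show ?thesis
  proof (intro conjI impI ballI iii iv)
    show "mcbc_min n k m r \<ge> enat (r * n)" if "k \<le> r * n"
      using mcbc_size_ge[OF C assms(3) that] by (simp add: min)
    show "mcbc_min n k m r \<ge> mcbc_min n k m i" if "i \<in> {1..r - 1}" for i
      using that by (intro mcbc_min_mono_multiplicity) auto
    show "mcbc_min n k m r \<le> cbc_min (r * n) k m" by (rule mcbc_min_le_cbc_min[OF assms(2)])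
    fix c assume "c \<in> {r..k - 1}"
    then have "c < k" using assms by auto
    from mcbc_size_ge_nc[OF C assms(2) this assms(4)]
    show "ereal_of_enat (mcbc_min n k m r) \<ge>
          ereal (real n * real c -
            of_int \<lfloor>(real k - real c) / (real m - real k + 1) *
              (of_int \<lfloor>(real k - 1) / real r\<rfloor> * real (m choose (k - 1)) /
                 real ((m - c) choose (k - 1 - c)) - real n)\<rfloor>)"
      by (simp add: min)
  qed
qed

end
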